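(* For every prime $p>2$, \[ \sum_{n=0}^{p-1} \frac{(-1)^n(40n^2+24n+3)}{2^{8n}(2n+1)}\binom{4n}{2n}^2\binom{2n}{n} \equiv 0 \pmod{p},\qquad \sum_{n=0}^{p-1}\frac{(-1)^n(80n^3 + 96n^2 + 30n + 3)}{2^{8n}} \binom{4n}{2n}^2 \binom{2n}{n} \equiv 0 \pmod{p}, \] and \[ \sum_{n=0}^{p-1} \frac{48n^2+32n+3}{2^{12n}(2n+1)}\binom{4n}{2n}^2\binom{2n}{n} \equiv 0 \pmod{p},\qquad \sum_{n=0}^{p-1}\frac{-96n^3 + 48n^2 + 26n + 3}{2^{12n}} \binom{4n}{2n}^2 \binom{2n}{n} \equiv 0 \pmod{p}. \]
   Context: For rational numbers $x,y$ and a prime $p$, $x\equiv y\pmod{p^r}$ means that $x-y$ is a rational number whose $p$-adic valuation is at least $r$. *)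

theory Defs
  imports Complex_Main "HOL-Computational_Algebra.Primes"
begin

(* Only meaningful for x \<noteq> 0: the valuation of 0 is infinite, but this function returns 0 there. *)
definition padic_val :: "nat \<Rightarrow> rat \<Rightarrow> int" where
  "padic_val p x =
     int (multiplicity (int p) (fst (quotient_of x))) -
     int (multiplicity (int p) (snd (quotient_of x)))"

(* Congruence of rationals modulo p ^ r; the case x = y covers valuation infinity. *)
definition rat_cong :: "nat \<Rightarrow> nat \<Rightarrow> rat \<Rightarrow> rat \<Rightarrow> bool" where
  "rat_cong p r x y \<longleftrightarrow> x = y \<or> padic_val p (x - y) \<ge> int r"

end

theory Submission
  imports Defs
begin

text \<open>
  Write \<open>h k\<close> for the Pochhammer symbol \<open>(1/2)\<^sub>k\<close>. Up to powers of 2, all four summands are a polynomial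
  in \<open>n\<close> times \<open>h (2n)\<^sup>2 / ((2n+1)! n!\<^sup>2)\<close>, and \<open>p\<close> divides \<open>h k\<close> as soon as \<open>2k > p\<close>; hence only
  \<open>n \<le> p/4\<close> matters modulo \<open>p\<close>. The quadratic summands are, up to a constant, \<open>G n 0\<close> for a
  Wilf--Zeilberger pair \<open>F (n+1) j - F n j = G n (j+1) - G n j\<close>, where \<open>F 0 j = 0\<close>. Summing over a
  rectangle, the sum of \<open>G n 0\<close> becomes a boundary contribution in which every term is divisible by \<open>p\<close>.
\<close>

section \<open>Rationals that are integral at a prime\<close>

text \<open>The localization of the integers at p. The fraction need not be reduced, so closure
  under the ring operations needs no gcd argument.\<close>

definition pint :: "nat \<Rightarrow> rat set" where
  "pint p = {x. \<exists>a b::int. \<not> int p dvd b \<and> x = of_int a / of_int b}"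

definition pmul :: "nat \<Rightarrow> rat set" where
  "pmul p = {x. \<exists>y \<in> pint p. x = of_nat p * y}"

text \<open>Cross-multiplying with the reduced fraction \<open>r / s\<close> moves the factor p into
  \<open>r\<close>, and coprimality keeps it out of \<open>s\<close>.\<close>

lemma rat_cong_0_if_pmul:
  assumes p: "prime p" and x: "x \<in> pmul p"
  shows "rat_cong p 1 x 0"
proof (cases "x = 0")
  case True
  then show ?thesis by (simp add: rat_cong_def)
next
  case False
  obtain r s where rs: "quotient_of x = (r, s)" by fastforce
  have s: "s > 0" and cop: "coprime r s" and xq: "x = of_int r / of_int s"
    using rs quotient_of_denom_pos quotient_of_coprime quotient_of_div by blast+
  from x obtain a b :: int where b: "\<not> int p dvd b" and xp: "x = of_nat p * (of_int a / of_int b)"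
    unfolding pmul_def pint_def by blast
  have "b \<noteq> 0" using b by auto
  have "of_int (r * b) = (of_int (int p * a * s) :: rat)"
    using xq xp s \<open>b \<noteq> 0\<close> by (simp add: field_simps)
  then have e: "r * b = int p * a * s" by (simp only: of_int_eq_iff)
  have pp: "prime (int p)" using p by simp
  have "int p dvd r * b" using e by simp
  then have pr: "int p dvd r" using b pp by (simp add: prime_dvd_mult_iff)
  then have ps: "\<not> int p dvd s"
    using cop pp not_prime_unit coprime_common_divisor by blast
  have "r \<noteq> 0" using False xq by auto
  then have "multiplicity (int p) r \<ge> 1"
    using pr pp by (metis multiplicity_geI not_prime_unit power_one_right)
  moreover have "multiplicity (int p) s = 0"
    using ps by (simp add: not_dvd_imp_multiplicity_0)
  ultimately show ?thesis by (simp add: rat_cong_def padic_val_def rs)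
qed

locale odd_prime =
  fixes p :: nat
  assumes prime: "prime p" and gt2: "p > 2"
begin

lemma pint_of_int [simp]: "of_int a \<in> pint p"
proof -
  have "\<not> int p dvd 1" using prime using gt2 by simp
  then show ?thesis unfolding pint_def by (metis (mono_tags, lifting) div_by_1 mem_Collect_eq of_int_1)
qed

lemma pint_of_nat [simp]: "of_nat a \<in> pint p"
  using pint_of_int [of "int a"] by simp

lemma pint_numeral [simp]: "numeral k \<in> pint p"
  using pint_of_nat [of "numeral k"] by simp

lemma pint_0 [simp]: "0 \<in> pint p" and pint_1 [simp]: "1 \<in> pint p"
  using pint_of_nat [of 0] pint_of_nat [of 1] by simp_all

lemma pint_mult: "x \<in> pint p \<Longrightarrow> y \<in> pint p \<Longrightarrow> x * y \<in> pint p"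
proof -
  assume "x \<in> pint p" "y \<in> pint p"
  then obtain a b c d :: int where
    "\<not> int p dvd b" "x = of_int a / of_int b" "\<not> int p dvd d" "y = of_int c / of_int d"
    by (auto simp: pint_def)
  then have "\<not> int p dvd b * d \<and> x * y = of_int (a * c) / of_int (b * d)"
    using prime by (simp add: prime_dvd_mult_iff)
  then show ?thesis unfolding pint_def by blast
qed

lemma pint_add: "x \<in> pint p \<Longrightarrow> y \<in> pint p \<Longrightarrow> x + y \<in> pint p"
proof -
  assume "x \<in> pint p" "y \<in> pint p"
  then obtain a b c d :: int where bd:
    "\<not> int p dvd b" "x = of_int a / of_int b" "\<not> int p dvd d" "y = of_int c / of_int d"
    by (auto simp: pint_def)
  moreover have "b \<noteq> 0" "d \<noteq> 0" using bd by auto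
  ultimately have "\<not> int p dvd b * d \<and> x + y = of_int (a * d + c * b) / of_int (b * d)"
    using prime by (simp add: prime_dvd_mult_iff field_simps)
  then show ?thesis unfolding pint_def by blast
qed

lemma pint_uminus: "x \<in> pint p \<Longrightarrow> - x \<in> pint p"
  using pint_mult [of "of_int (-1)" x] pint_of_int [of "-1"] by simp

lemma pint_diff: "x \<in> pint p \<Longrightarrow> y \<in> pint p \<Longrightarrow> x - y \<in> pint p"
  using pint_add [of x "- y"] pint_uminus by simp

lemma pint_power: "x \<in> pint p \<Longrightarrow> x ^ k \<in> pint p"
  by (induction k) (auto intro: pint_mult)

lemma pint_inverse_of_nat: "\<not> p dvd k \<Longrightarrow> inverse (of_nat k) \<in> pint p"
  unfolding pint_def
  by (rule CollectI, rule exI [of _ 1], rule exI [of _ "int k"]) (simp add: inverse_eq_divide)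

lemma pint_divide_of_nat: "x \<in> pint p \<Longrightarrow> \<not> p dvd k \<Longrightarrow> x / of_nat k \<in> pint p"
  by (simp add: divide_inverse pint_mult pint_inverse_of_nat)

lemma pint_divide_power: "x \<in> pint p \<Longrightarrow> \<not> p dvd k \<Longrightarrow> x / of_nat k ^ i \<in> pint p"
  using pint_divide_of_nat [of x "k ^ i"] prime prime_dvd_power by auto

lemma not_dvd_2: "\<not> p dvd 2"
  using gt2 by (auto dest: dvd_imp_le)

lemma pint_half: "x \<in> pint p \<Longrightarrow> x / 2 \<in> pint p"
  using pint_divide_of_nat [of x 2] not_dvd_2 by simp

lemma not_dvd_2_power: "\<not> p dvd 2 ^ k"
  using not_dvd_2 prime prime_dvd_power by blast

lemma pint_divide_2_power: "x \<in> pint p \<Longrightarrow> x / 2 ^ k \<in> pint p"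
  using pint_divide_of_nat [of x "2 ^ k"] not_dvd_2_power by simp

lemma pint_pochhammer: "x \<in> pint p \<Longrightarrow> pochhammer x n \<in> pint p"
  by (induction n) (auto simp: pochhammer_Suc intro!: pint_mult pint_add)

lemma not_dvd_fact: "k < p \<Longrightarrow> \<not> p dvd fact k"
  using prime by (simp add: prime_dvd_fact_iff)

lemma pint_divide_fact: "x \<in> pint p \<Longrightarrow> k < p \<Longrightarrow> x / fact k \<in> pint p"
  using pint_divide_of_nat [of x "fact k"] not_dvd_fact by simp

text \<open>Among p, ..., 2p - 1 only p itself is a multiple of p, so the factorial contains p
  exactly once.\<close>

lemma fact_double_prime: "r < p \<Longrightarrow> \<exists>m. fact (p + r) = p * m \<and> \<not> p dvd m"
proof (induction r)
  case 0
  have "fact p = p * fact (p - 1)" using fact_reduce [of p, where 'a = nat] gt2 by simp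
  then show ?case using not_dvd_fact [of "p - 1"] gt2 by (intro exI [of _ "fact (p - 1)"]) simp
next
  case (Suc r)
  then obtain m where m: "fact (p + r) = p * m" "\<not> p dvd m" by auto
  have "\<not> p dvd Suc (p + r)"
    using Suc.prems by (metis add_Suc_right dvd_add_triv_left_iff nat_dvd_not_less zero_less_Suc)
  then have "\<not> p dvd Suc (p + r) * m" using m prime prime_dvd_mult_iff by blast
  moreover have "fact (p + Suc r) = p * (Suc (p + r) * m)" using m by (simp add: algebra_simps)
  ultimately show ?case by blast
qed

lemma pint_prime_divide_fact:
  assumes "k < 2 * p"
  shows "of_nat p / fact k \<in> pint p"
proof (cases "k < p")
  case True
  then show ?thesis by (simp add: pint_divide_fact)
next
  case False
  then have "k - p < p" "p + (k - p) = k" using assms by linarith+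
  then obtain m where m: "fact k = p * m" "\<not> p dvd m"
    using fact_double_prime [of "k - p"] by auto
  have "(fact k :: rat) = of_nat (fact k)" by simp
  also have "\<dots> = of_nat p * of_nat m" by (simp only: m of_nat_mult)
  finally have "of_nat p / (fact k :: rat) = inverse (of_nat m)"
    using gt2 by (simp add: field_simps)
  then show ?thesis using m pint_inverse_of_nat by simp
qed

section \<open>Multiples of p among the p-integral rationals\<close>

lemma pmul_add: "x \<in> pmul p \<Longrightarrow> y \<in> pmul p \<Longrightarrow> x + y \<in> pmul p"
  unfolding pmul_def by (auto simp: distrib_left [symmetric] intro: pint_add)

lemma pmul_mult: "x \<in> pmul p \<Longrightarrow> y \<in> pint p \<Longrightarrow> x * y \<in> pmul p"
  unfolding pmul_def by (auto simp: mult.assoc intro: pint_mult)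

lemma pmul_mult': "x \<in> pint p \<Longrightarrow> y \<in> pmul p \<Longrightarrow> x * y \<in> pmul p"
  using pmul_mult [of y x] by (simp add: mult.commute)

lemma pmul_uminus: "x \<in> pmul p \<Longrightarrow> - x \<in> pmul p"
  using pmul_mult [of x "-1"] pint_uminus [of 1] by simp

lemma pmul_diff: "x \<in> pmul p \<Longrightarrow> y \<in> pmul p \<Longrightarrow> x - y \<in> pmul p"
  using pmul_add [of x "- y"] pmul_uminus by simp

lemma pmul_0 [simp]: "0 \<in> pmul p"
  by (auto simp: pmul_def intro!: bexI [of _ 0])

lemma pmul_prime: "y \<in> pint p \<Longrightarrow> of_nat p * y \<in> pmul p"
  by (auto simp: pmul_def)

lemma pmul_sum: "(\<And>i. i \<in> A \<Longrightarrow> f i \<in> pmul p) \<Longrightarrow> sum f A \<in> pmul p"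
  by (induction A rule: infinite_finite_induct) (auto intro: pmul_add)

text \<open>Below 2p the factorial cancels at most one of the two factors p, so one
  survives.\<close>

lemma pmul_square_divide_fact:
  assumes "x \<in> pmul p" "y \<in> pmul p" "k < 2 * p"
  shows "x * y / fact k \<in> pmul p"
proof -
  obtain a b where ab: "a \<in> pint p" "x = of_nat p * a" "b \<in> pint p" "y = of_nat p * b"
    using assms by (auto simp: pmul_def)
  have e: "x * y / fact k = of_nat p * (a * b * (of_nat p / fact k))"
    by (simp add: ab)
  show ?thesis
    unfolding e using ab pint_prime_divide_fact [OF assms(3)] by (intro pmul_prime pint_mult)
qed

end

section \<open>The hypergeometric terms\<close>

abbreviation half_poch :: "nat \<Rightarrow> rat" where
  "half_poch n \<equiv> pochhammer (1/2) n"

text \<open>Absorbing the denominator 2n + 1 into the factorial means that the index with 2n + 1 = p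
  needs no special treatment.\<close>

definition hyp :: "nat \<Rightarrow> rat" where
  "hyp n = half_poch (2 * n) ^ 2 / (fact (2 * n + 1) * fact n ^ 2)"

lemma half_poch_eq: "half_poch n = fact (2 * n) / (4 ^ n * fact n)"
  using fact_double [of n, where 'a = rat] by (simp add: power_mult)

lemma half_poch_pos: "half_poch n > 0"
  by (intro pochhammer_pos) simp

lemma linear_of_nat_neq_0 [simp]:
  "of_nat n + 1 \<noteq> (0 :: rat)" "2 * of_nat n + 1 \<noteq> (0 :: rat)" "2 * of_nat n + 3 \<noteq> (0 :: rat)"
proof -
  have "(of_nat (n + 1) :: rat) \<noteq> 0" "(of_nat (2 * n + 1) :: rat) \<noteq> 0" "(of_nat (2 * n + 3) :: rat) \<noteq> 0"
    by (simp_all only: of_nat_eq_0_iff)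
  then show "of_nat n + 1 \<noteq> (0 :: rat)" "2 * of_nat n + 1 \<noteq> (0 :: rat)" "2 * of_nat n + 3 \<noteq> (0 :: rat)"
    by simp_all
qed

lemma binomials_eq_hyp:
  "of_nat ((4 * n) choose (2 * n)) ^ 2 * of_nat ((2 * n) choose n)
     = 2 ^ (8 * n) * (2 * of_nat n + 1) * hyp n"
proof -
  have 1: "of_nat ((4 * n) choose (2 * n)) = (fact (4 * n) / (fact (2 * n) * fact (2 * n)) :: rat)"
    using binomial_fact [of "2 * n" "4 * n", where 'a = rat] by simp
  have 2: "of_nat ((2 * n) choose n) = (fact (2 * n) / (fact n * fact n) :: rat)"
    using binomial_fact [of n "2 * n", where 'a = rat] by (simp add: mult_2)
  have 3: "(2 :: rat) ^ (8 * n) = (4 ^ (2 * n)) ^ 2"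
    by (simp add: power_mult power2_eq_square flip: power_mult_distrib)
  have 4: "(fact (2 * n + 1) :: rat) = (2 * of_nat n + 1) * fact (2 * n)"
    by simp
  have 5: "half_poch (2 * n) = fact (4 * n) / (4 ^ (2 * n) * fact (2 * n))"
    using half_poch_eq [of "2 * n"] by simp
  define e :: rat where "e = 2 * of_nat n + 1"
  have "e \<noteq> 0" by (simp add: e_def)
  then show ?thesis
    unfolding hyp_def 1 2 3 4 5 e_def [symmetric]
    by (simp add: field_simps power2_eq_square)
qed

lemma half_poch_double_Suc:
  "half_poch (2 * Suc n) = half_poch (2 * n) * ((4 * of_nat n + 1) * (4 * of_nat n + 3) / 4)"
  by (simp add: pochhammer_Suc field_simps)

lemma hyp_Suc:
  "hyp (Suc n) = hyp n * ((4 * of_nat n + 1) ^ 2 * (4 * of_nat n + 3) ^ 2 /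
      (32 * (of_nat n + 1) ^ 3 * (2 * of_nat n + 3)))"
proof -
  have f: "(fact (2 * Suc n + 1) :: rat) = 2 * (of_nat n + 1) * (2 * of_nat n + 3) * fact (2 * n + 1)"
    by (simp add: algebra_simps)
  have g: "(fact (Suc n) :: rat) = (of_nat n + 1) * fact n"
    by (simp add: algebra_simps)
  show ?thesis
    unfolding hyp_def half_poch_double_Suc f g
    by (simp add: field_simps power2_eq_square power3_eq_cube)
qed


section \<open>Two Wilf--Zeilberger pairs\<close>

text \<open>Sum the relation over the rectangle n < M, j < J, telescoping in j on one side and in n
  on the other.\<close>

lemma sum_telescope_2:
  fixes F G :: "nat \<Rightarrow> nat \<Rightarrow> 'a::ab_group_add"
  assumes "\<And>n j. F (Suc n) j - F n j = G n (Suc j) - G n j"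
  shows "(\<Sum>n<M. G n 0) = (\<Sum>n<M. G n J) - (\<Sum>j<J. F M j - F 0 j)"
proof -
  have "(\<Sum>n<M. G n J - G n 0) = (\<Sum>n<M. \<Sum>j<J. G n (Suc j) - G n j)"
    by (simp add: sum_lessThan_telescope)
  also have "\<dots> = (\<Sum>j<J. \<Sum>n<M. F (Suc n) j - F n j)"
    by (subst sum.swap) (simp add: assms)
  also have "\<dots> = (\<Sum>j<J. F M j - F 0 j)"
    by (rule sum.cong [OF refl]) (rule sum_lessThan_telescope)
  finally show ?thesis by (simp add: sum_subtractf algebra_simps)
qed

text \<open>By parity; this keeps the half-integral denominators of \<open>UF\<close> away from
  0.\<close>

lemma of_nat_neq_half: "of_nat a - 1/2 - of_nat b \<noteq> (0 :: rat)"
proof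
  assume "of_nat a - 1/2 - of_nat b = (0 :: rat)"
  then have "(of_nat (2 * a) :: rat) = of_nat (2 * b + 1)" by (simp add: field_simps)
  then have "2 * a = 2 * b + 1" by (simp only: of_nat_eq_iff)
  then show False by presburger
qed

text \<open>The first pair is a specialization of Gauss' summation
  \<open>\<Sum>k. (a)\<^sub>k (b)\<^sub>k / (k! (c)\<^sub>k)\<close> with \<open>(a, b)\<close> shifted by \<open>(-2n, n)\<close>, at \<open>a = 1/2\<close>, \<open>b = 0\<close>, \<open>c = 1\<close>,
  with \<open>k\<close> running through the half-integers \<open>1/2 - j\<close>.\<close>

definition U :: "nat \<Rightarrow> nat \<Rightarrow> rat" where
  "U n j = (-1) ^ n * half_poch (2 * n) ^ 2 * half_poch j * pochhammer (1/2 - of_nat j) n /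
     (fact (2 * n + 1 + j) * fact n ^ 2 * half_poch n)"

text \<open>A rational certificate times \<open>U\<close>; the factor n^2 makes the boundary term at
  n = 0 vanish.\<close>

definition UF :: "nat \<Rightarrow> nat \<Rightarrow> rat" where
  "UF n j = U n j * of_nat n ^ 2 * (2 * of_nat n + 1 + of_nat j) / (of_nat n - 1/2 - of_nat j)"

text \<open>At j = 0 the Pochhammer symbol in \<open>U\<close> cancels \<open>half_poch n\<close>,
  which leaves a quarter of the first summand.\<close>

definition UG :: "nat \<Rightarrow> nat \<Rightarrow> rat" where
  "UG n j = U n j * ((40 * of_nat n ^ 2 + 24 * of_nat n + 3) / 4
     - 2 * of_nat j * of_nat n ^ 2 / (2 * of_nat n + 1))"

lemma U_Suc_left:
  "U (Suc n) j = - U n j * ((4 * of_nat n + 1) ^ 2 * (4 * of_nat n + 3) ^ 2 * (1/2 - of_nat j + of_nat n) /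
     (8 * (2 * of_nat n + 2 + of_nat j) * (2 * of_nat n + 3 + of_nat j) * (of_nat n + 1) ^ 2 * (2 * of_nat n + 1)))"
proof -
  \<comment> \<open>Opaque names keep the linear factors as atoms that cancel without being
    multiplied out.\<close>
  define A B a b c e d k l :: rat where defs: "A = fact (2 * n + 1 + j)" "B = fact n"
    "a = 2 * of_nat n + 2 + of_nat j" "b = 2 * of_nat n + 3 + of_nat j" "c = of_nat n + 1"
    "e = 2 * of_nat n + 1" "d = 1/2 - of_nat j + of_nat n" "k = 4 * of_nat n + 1" "l = 4 * of_nat n + 3"
  have f: "(fact (2 * Suc n + 1 + j) :: rat) = a * b * A"
    by (simp add: defs algebra_simps)
  have g: "(fact (Suc n) :: rat) = c * B"
    by (simp add: defs algebra_simps)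
  have h: "half_poch (Suc n) = half_poch n * e / 2"
    by (simp add: defs pochhammer_Suc field_simps)
  show ?thesis
    unfolding U_def half_poch_double_Suc f g h pochhammer_Suc [of "1/2 - of_nat j" n] defs(1-2) [symmetric]
    unfolding defs(3-) [symmetric]
    by (simp add: power_mult_distrib power_divide mult_ac)
qed

lemma U_Suc_right:
  "U n (Suc j) * ((of_nat n - 1/2 - of_nat j) * (2 * of_nat n + 2 + of_nat j)) = - U n j * (1/2 + of_nat j) ^ 2"
proof -
  let ?a = "1/2 - of_nat (Suc j) :: rat"
  define w :: rat where "w = 1/2 + of_nat j"
  have f: "(fact (2 * n + 1 + Suc j) :: rat) = (2 * of_nat n + 2 + of_nat j) * fact (2 * n + 1 + j)"
    by (simp add: algebra_simps)
  have nz: "2 * of_nat n + 2 + of_nat j \<noteq> (0 :: rat)"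
    using of_nat_0_le_iff [of n, where 'a = rat] of_nat_0_le_iff [of j, where 'a = rat] by linarith
  have a: "?a + of_nat n = of_nat n - 1/2 - of_nat j" and a1: "?a + 1 = 1/2 - of_nat j"
    by simp_all
  \<comment> \<open>The Pochhammer symbol of length n + 1 is split at its first and at its last
    factor, which relates the parameters \<open>?a\<close> and \<open>?a + 1\<close>.\<close>
  have "pochhammer ?a n * (?a + of_nat n) = ?a * pochhammer (?a + 1) n"
    using pochhammer_rec [of ?a n] pochhammer_Suc [of ?a n] by simp
  then have p: "pochhammer ?a n * (of_nat n - 1/2 - of_nat j) = - (1/2 + of_nat j) * pochhammer (1/2 - of_nat j) n"
    unfolding a a1 by simp
  have "U n (Suc j) * ((of_nat n - 1/2 - of_nat j) * (2 * of_nat n + 2 + of_nat j)) =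
     (-1) ^ n * half_poch (2 * n) ^ 2 * (half_poch j * (1/2 + of_nat j)) *
      (pochhammer ?a n * (of_nat n - 1/2 - of_nat j)) / (fact (2 * n + 1 + j) * fact n ^ 2 * half_poch n)"
    unfolding U_def f pochhammer_Suc [of _ j] using nz by simp
  also have "\<dots> = - U n j * (1/2 + of_nat j) ^ 2"
    unfolding p U_def w_def [symmetric] by (simp add: power2_eq_square)
  finally show ?thesis .
qed

lemma U_WZ: "UF (Suc n) j - UF n j = UG n (Suc j) - UG n j"
proof -
  define x y u :: rat where "x = of_nat n" and "y = of_nat j" and "u = U n j"
  have pos: "x \<ge> 0" "y \<ge> 0" by (simp_all add: x_def y_def)
  have nz1: "x - 1/2 - y \<noteq> 0" using of_nat_neq_half by (simp add: x_def y_def)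
  have nz2: "1/2 - y + x \<noteq> 0"
    using of_nat_neq_half [of "Suc n" j] by (simp add: x_def y_def algebra_simps)
  have nz: "2 * x + 2 + y \<noteq> 0" "2 * x + 3 + y \<noteq> 0" "x + 1 \<noteq> 0" "2 * x + 1 \<noteq> 0" using pos by linarith+
  have R: "U n (Suc j) = - u * (1/2 + y) ^ 2 / ((x - 1/2 - y) * (2 * x + 2 + y))"
    using U_Suc_right [of n j] nz(1) nz1
    unfolding x_def y_def u_def by (intro nonzero_eq_divide_eq [THEN iffD2]) auto
  have L: "U (Suc n) j = - u * ((4 * x + 1) ^ 2 * (4 * x + 3) ^ 2 * (1/2 - y + x) /
     (8 * (2 * x + 2 + y) * (2 * x + 3 + y) * (x + 1) ^ 2 * (2 * x + 1)))"
    by (simp add: U_Suc_left x_def y_def u_def)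
  \<comment> \<open>The last factor of the Pochhammer symbol cancels the half-integral
    denominator.\<close>
  have A: "UF (Suc n) j = - u * ((4 * x + 1) ^ 2 * (4 * x + 3) ^ 2) / (8 * (2 * x + 2 + y) * (2 * x + 1))"
  proof -
    have "UF (Suc n) j = U (Suc n) j * (x + 1) ^ 2 * (2 * x + 3 + y) / (1/2 - y + x)"
      by (simp add: UF_def x_def y_def algebra_simps)
    then show ?thesis unfolding L using nz nz2 by simp
  qed
  have B: "UF n j = u * x ^ 2 * (2 * x + 1 + y) / (x - 1/2 - y)"
    by (simp add: UF_def x_def y_def u_def)
  have C: "UG n (Suc j) = - u * (1/2 + y) ^ 2 / ((x - 1/2 - y) * (2 * x + 2 + y)) *
      ((40 * x ^ 2 + 24 * x + 3) / 4 - 2 * (y + 1) * x ^ 2 / (2 * x + 1))"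
    unfolding UG_def R by (simp add: x_def y_def algebra_simps)
  have D: "UG n j = u * ((40 * x ^ 2 + 24 * x + 3) / 4 - 2 * y * x ^ 2 / (2 * x + 1))"
    by (simp add: UG_def x_def y_def u_def)
  \<comment> \<open>Once denominators are cleared, eliminating y in favour of d leaves a polynomial
    identity in x, d and u.\<close>
  define d where "d = x - 1/2 - y"
  have d: "d \<noteq> 0" "y = x - 1/2 - d" using nz1 by (simp_all add: d_def)
  show ?thesis
    unfolding A B C D d_def [symmetric] using nz d(1)
    by (simp add: divide_simps) (simp add: d(2), algebra)
qed

text \<open>The second pair comes from Gauss' summation with \<open>a = 1/4\<close>, \<open>b = 3/4\<close>, \<open>c = 1\<close>, where \<open>a\<close> and \<open>b\<close>
  are shifted by \<open>-n\<close> and \<open>k\<close> is shifted by \<open>n\<close>.\<close>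

definition V :: "nat \<Rightarrow> nat \<Rightarrow> rat" where
  "V n j = half_poch (2 * n) ^ 2 * half_poch (2 * j) / (16 ^ n * 4 ^ j * fact (n + j) ^ 2 * fact (2 * n + 1))"

definition VF :: "nat \<Rightarrow> nat \<Rightarrow> rat" where
  "VF n j = V n j * (2 * of_nat n * (2 * of_nat n + 1))"

definition VG :: "nat \<Rightarrow> nat \<Rightarrow> rat" where
  "VG n j = V n j * ((48 * of_nat n ^ 2 + 32 * of_nat n + 3) / 16 + (2 * of_nat n + 1) * of_nat j)"

text \<open>Both neighbours of \<open>V n j\<close> are rational multiples of it, so the claim
  becomes a polynomial identity in n and j.\<close>

lemma V_WZ: "VF (Suc n) j - VF n j = VG n (Suc j) - VG n j"
proof -
  define x y u :: rat where "x = of_nat n" and "y = of_nat j" and "u = V n j"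
  have pos: "x \<ge> 0" "y \<ge> 0" by (simp_all add: x_def y_def)
  have nz: "x + y + 1 \<noteq> 0" "2 * x + 3 \<noteq> 0" "x + 1 \<noteq> 0" "2 * x + 1 \<noteq> 0" using pos by linarith+
  have f: "(fact (2 * Suc n + 1) :: rat) = 2 * (x + 1) * (2 * x + 3) * fact (2 * n + 1)"
    by (simp add: x_def algebra_simps)
  have g: "(fact (Suc n + j) :: rat) = (x + y + 1) * fact (n + j)"
    by (simp add: x_def y_def algebra_simps)
  have L: "V (Suc n) j = u * ((4 * x + 1) ^ 2 * (4 * x + 3) ^ 2 / (512 * (x + y + 1) ^ 2 * (x + 1) * (2 * x + 3)))"
    unfolding u_def V_def half_poch_double_Suc f g x_def [symmetric] by (simp add: power_mult_distrib power_divide divide_simps)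
  have R: "V n (Suc j) = u * ((4 * y + 1) * (4 * y + 3) / (16 * (x + y + 1) ^ 2))"
    unfolding u_def V_def half_poch_double_Suc add_Suc_right add_Suc [symmetric] g by (simp add: y_def power_mult_distrib mult_ac)
  have A: "VF (Suc n) j = u * ((4 * x + 1) ^ 2 * (4 * x + 3) ^ 2 / (256 * (x + y + 1) ^ 2))"
  proof -
    define s t where "s = x + 1" and "t = 2 * x + 3"
    have "VF (Suc n) j = V (Suc n) j * (2 * s * t)"
      by (simp add: VF_def s_def t_def x_def algebra_simps)
    moreover have "s \<noteq> 0" "t \<noteq> 0" using nz by (simp_all add: s_def t_def)
    ultimately show ?thesis unfolding L s_def [symmetric] t_def [symmetric] by simp
  qed
  have C: "VG n (Suc j) = u * ((4 * y + 1) * (4 * y + 3) / (16 * (x + y + 1) ^ 2)) *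
     ((48 * x ^ 2 + 32 * x + 3) / 16 + (2 * x + 1) * (y + 1))"
    unfolding VG_def R by (simp add: x_def y_def algebra_simps)
  show ?thesis
    unfolding A C unfolding VF_def VG_def x_def [symmetric] y_def [symmetric] u_def [symmetric] using nz(1)
    by (simp add: divide_simps) algebra
qed

section \<open>Reduction modulo the prime\<close>

context odd_prime
begin

lemma odd_p: "odd p"
  using prime gt2 prime_odd_nat by blast

lemma not_dvd_double_Suc: "4 * n < p \<Longrightarrow> \<not> p dvd 2 * n + 1"
  using gt2 by (auto dest!: dvd_imp_le)

lemma pint_divide_double_Suc:
  "x \<in> pint p \<Longrightarrow> 4 * n < p \<Longrightarrow> x / (2 * of_nat n + 1) \<in> pint p"
  using pint_divide_of_nat [of x "2 * n + 1"] not_dvd_double_Suc [of n] by (simp add: add.commute)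

text \<open>Both rectangles end at n = \<open>Suc (p div 4)\<close>, the first n with 4n > p: there
  p divides \<open>half_poch (2 * n)\<close>, while 2n < p still keeps \<open>half_poch n\<close>
  invertible.\<close>

lemma div_4_bounds: "4 * (p div 4) < p" "p < 4 * Suc (p div 4)" "2 * Suc (p div 4) < p"
proof -
  have "p mod 4 \<noteq> 0" using odd_p by (metis dvd_trans even_numeral mod_eq_0_iff_dvd)
  then show "4 * (p div 4) < p" using mult_div_mod_eq [of 4 p] by linarith
  show "p < 4 * Suc (p div 4)" using dividend_less_times_div [of 4 p] by simp
  with \<open>4 * (p div 4) < p\<close> show "2 * Suc (p div 4) < p"
    using gt2 by (cases "p div 4") auto
qed

section \<open>Divisibility by p of Pochhammer symbols and of \<open>hyp\<close>\<close>

lemma pint_half_poch: "half_poch n \<in> pint p"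
  by (simp add: pint_pochhammer pint_half)

text \<open>With p = 2k + 1 the product contains the factor 1/2 + k = p/2.\<close>

lemma pmul_half_poch:
  assumes "p < 2 * n"
  shows "half_poch n \<in> pmul p"
proof -
  obtain k where k: "p = 2 * k + 1" using odd_p oddE by blast
  have n: "Suc k \<le> n" using assms k by simp
  have "half_poch (Suc k) = of_nat p * (half_poch k / 2)"
    by (simp add: pochhammer_Suc k field_simps)
  then have e: "half_poch n = of_nat p * (half_poch k / 2) * pochhammer (1/2 + of_nat (Suc k)) (n - Suc k)"
    using pochhammer_product [OF n, of "1/2 :: rat"] by simp
  show ?thesis
    unfolding e
    by (intro pmul_mult pmul_prime pint_half pint_half_poch pint_pochhammer pint_add pint_1 pint_of_nat)
qed

text \<open>The reciprocal of \<open>half_poch n\<close> is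
  \<open>4 ^ n * fact n / fact (2 * n)\<close>, and p does not divide
  \<open>fact (2 * n)\<close>.\<close>

lemma pint_divide_half_poch:
  assumes "x \<in> pint p" "2 * n < p"
  shows "x / half_poch n \<in> pint p"
proof -
  have "x / half_poch n = x * 4 ^ n * fact n / fact (2 * n)"
    by (simp add: half_poch_eq)
  moreover have "x * 4 ^ n * fact n \<in> pint p"
    using assms pint_of_nat [of "fact n"] by (auto intro!: pint_mult pint_power)
  ultimately show ?thesis using assms by (simp add: pint_divide_fact)
qed

text \<open>The square in the numerator supplies p twice, (2n + 1)! removes it at most once since 2n
  + 1 < 2p, and n! is prime to p.\<close>

lemma pmul_hyp:
  assumes "p < 4 * n" "n < p"
  shows "hyp n \<in> pmul p"
proof -
  have h: "half_poch (2 * n) \<in> pmul p" using assms by (intro pmul_half_poch) simp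
  have f: "1 / (fact n :: rat) ^ 2 \<in> pint p"
    using pint_divide_power [of 1 "fact n" 2] not_dvd_fact assms by simp
  have "hyp n = half_poch (2 * n) * half_poch (2 * n) / fact (2 * n + 1) * (1 / fact n ^ 2)"
    by (simp add: hyp_def power2_eq_square)
  then show ?thesis
    using pmul_mult [OF pmul_square_divide_fact [OF h h, of "2 * n + 1"] f] assms by simp
qed

text \<open>At n = p the factorials contain several factors p, so integrality comes from the integer
  binomials instead. This term is the end point of the telescoping in the cubic sums.\<close>

lemma pint_hyp_p: "hyp p \<in> pint p"
proof -
  have "\<not> p dvd 2 * p + 1"
    using gt2 by (metis dvd_add_right_iff dvd_triv_right nat_dvd_not_less one_less_numeral_iff
        less_trans semiring_norm(76) zero_less_one)
  then have "\<not> p dvd 2 ^ (8 * p) * (2 * p + 1)"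
    using not_dvd_2_power prime prime_dvd_mult_iff by blast
  moreover have "hyp p = of_nat (((4 * p) choose (2 * p)) ^ 2 * ((2 * p) choose p)) / of_nat (2 ^ (8 * p) * (2 * p + 1))"
  proof (rule nonzero_eq_divide_eq [THEN iffD2])
    show "of_nat (2 ^ (8 * p) * (2 * p + 1)) \<noteq> (0 :: rat)"
      by (simp only: of_nat_eq_0_iff) simp
    show "hyp p * of_nat (2 ^ (8 * p) * (2 * p + 1)) =
        of_nat (((4 * p) choose (2 * p)) ^ 2 * ((2 * p) choose p))"
      using binomials_eq_hyp [of p] by (simp add: algebra_simps)
  qed
  ultimately show ?thesis using pint_divide_of_nat [OF pint_of_nat] by metis
qed

lemma pmul_sum_hyp:
  assumes "(\<Sum>n<Suc (p div 4). c n * hyp n) \<in> pmul p" and "\<And>n. c n \<in> pint p"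
  shows "(\<Sum>n<p. c n * hyp n) \<in> pmul p"
proof -
  have "Suc (p div 4) \<le> p" using gt2 by linarith
  then have "(\<Sum>n<p. c n * hyp n) =
      (\<Sum>n<Suc (p div 4). c n * hyp n) + (\<Sum>n = Suc (p div 4)..<p. c n * hyp n)"
    unfolding lessThan_atLeast0 by (intro sum.atLeastLessThan_concat [symmetric]) auto
  moreover have "(\<Sum>n = Suc (p div 4)..<p. c n * hyp n) \<in> pmul p"
  proof (rule pmul_sum)
    fix n assume "n \<in> {Suc (p div 4)..<p}"
    then have "p div 4 < n" "n < p" by auto
    then have "p < 4 * n" "n < p" by linarith+
    then show "c n * hyp n \<in> pmul p" by (intro pmul_mult' assms pmul_hyp)
  qed
  ultimately show ?thesis using assms by (simp add: pmul_add)
qed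

section \<open>Boundary terms of the two rectangles\<close>

lemma pmul_UG:
  assumes n: "n < Suc (p div 4)" and J: "2 * J = Suc p"
  shows "UG n J \<in> pmul p"
proof -
  have n4: "4 * n < p" and J2: "p < 2 * J"
    using n J div_4_bounds by linarith+
  have hJ: "half_poch J \<in> pmul p" using J2 by (rule pmul_half_poch)
  show ?thesis
  proof (cases n)
    case 0
    \<comment> \<open>The Pochhammer symbol of length n in \<open>U\<close> is empty here, so only
      \<open>half_poch J\<close> provides p.\<close>
    have e: "UG n J = half_poch J * ((3 / 2 ^ 2) / fact (Suc J))"
      by (simp add: UG_def U_def 0)
    show ?thesis
    proof (cases "p = 3")
      \<comment> \<open>Here \<open>fact (Suc J)\<close> is 3! and cancels that p; the constant 3 of
        the quadratic replaces it.\<close>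
      case True
      then have "J = 2" using J by simp
      then have "UG n J = of_nat p * (1 / 2 ^ 5)"
        unfolding e True by (simp add: pochhammer_Suc eval_nat_numeral)
      then show ?thesis by (simp only: pmul_prime pint_divide_2_power pint_1)
    next
      case False
      then have "Suc J < p" using J gt2 by presburger
      then show ?thesis unfolding e
        by (intro pmul_mult hJ pint_divide_fact pint_divide_2_power) auto
    qed
  next
    case (Suc k)
    \<comment> \<open>Since J = (p + 1)/2, the first factor of the Pochhammer symbol is -p/2, a
      second p to set against (2n + 1 + J)!.\<close>
    have e: "1/2 - of_nat J = of_nat p * (-1/2 :: rat)"
    proof -
      have "(of_nat (2 * J) :: rat) = of_nat (Suc p)" using J by (simp only:)
      then show ?thesis by (simp add: field_simps)
    qed
    have P: "pochhammer (1/2 - of_nat J) n \<in> pmul p"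
      unfolding e Suc pochhammer_rec
      by (intro pmul_mult pmul_prime pint_mult pint_pochhammer pint_add pint_half pint_uminus pint_of_nat pint_1)
    have "2 * n + 1 + J < 2 * p" using n4 J gt2 by linarith
    then have *: "half_poch J * pochhammer (1/2 - of_nat J) n / fact (2 * n + 1 + J) \<in> pmul p"
      by (intro pmul_square_divide_fact hJ P)
    have "2 * n < p" "n < p" using n4 by linarith+
    then have **: "(-1) ^ n * half_poch (2 * n) ^ 2 / half_poch n / fact n / fact n *
       ((40 * of_nat n ^ 2 + 24 * of_nat n + 3) / 2 / 2 - 2 * of_nat J * of_nat n ^ 2 / (2 * of_nat n + 1)) \<in> pint p"
      using n4
      by (intro pint_mult pint_diff pint_add pint_half pint_divide_double_Suc pint_divide_fact
        pint_divide_half_poch pint_power pint_half_poch pint_of_nat pint_uminus pint_1 pint_numeral)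
    show ?thesis
      using pmul_mult [OF * **] by (simp add: UG_def U_def power2_eq_square mult_ac)
  qed
qed

lemma pmul_UF:
  assumes j: "2 * j < Suc p" and m: "m = p div 4"
  shows "UF (Suc m) j \<in> pmul p"
proof -
  define q r s :: rat where "q = of_nat (Suc m)" and "r = of_nat (2 * Suc m + 1 + j)"
    and "s = 1/2 - of_nat j + of_nat m"
  have nz: "q \<noteq> 0" "r \<noteq> 0" by (simp_all only: q_def r_def of_nat_eq_0_iff)
  have s: "s \<noteq> 0" "q - 1/2 - of_nat j = s"
    using of_nat_neq_half [of "Suc m" j] by (simp_all add: s_def q_def)
  have f: "fact (2 * Suc m + 1 + j) = r * fact (2 * Suc m + j)"
    by (simp add: r_def algebra_simps)
  have g: "fact (Suc m) = q * fact m" by (simp add: q_def)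
  \<comment> \<open>The certificate lowers each factorial by one step and cancels the last factor of
    the Pochhammer symbol; the remaining (2m + 2 + j)! contains p at most once.\<close>
  have e: "UF (Suc m) j = half_poch (2 * Suc m) * half_poch (2 * Suc m) / fact (2 * Suc m + j) *
     ((-1) ^ Suc m * half_poch j * pochhammer (1/2 - of_nat j) m / half_poch (Suc m) / fact m / fact m)"
  proof -
    have *: "2 * q + 1 + of_nat j = r" by (simp add: r_def q_def)
    show ?thesis
      unfolding UF_def U_def f g pochhammer_Suc [of "1/2 - of_nat j" m] s_def [symmetric]
      unfolding q_def [symmetric] s(2) *
      using nz s(1) by (simp add: power2_eq_square mult_ac del: of_nat_Suc)
  qed
  have "p < 2 * (2 * Suc m)" "2 * Suc m + j < 2 * p" "2 * Suc m < p" "m < p"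
    using j div_4_bounds by (simp_all add: m)
  then show ?thesis
    unfolding e
    by (intro pmul_mult pmul_square_divide_fact pmul_half_poch pint_mult pint_pochhammer pint_diff pint_add pint_half pint_divide_fact
        pint_divide_half_poch pint_power pint_half_poch pint_of_nat pint_uminus pint_1 pint_numeral)
qed

text \<open>At j = \<open>Suc m\<close> the single factor \<open>half_poch (2 * j)\<close> suffices,
  since every factorial in the denominator has an argument below p.\<close>

lemma pmul_VG:
  assumes n: "n < Suc m" and m: "m = p div 4"
  shows "VG n (Suc m) \<in> pmul p"
proof -
  have b: "p < 2 * (2 * Suc m)" "n + Suc m < p" "2 * n + 1 < p"
    using n div_4_bounds by (simp_all add: m)
  have "(16 :: rat) = 2 ^ 4" "(4 :: rat) = 2 ^ 2" by simp_all
  then have e: "VG n (Suc m) = half_poch (2 * Suc m) * (half_poch (2 * n) ^ 2 / 2 ^ (4 * n) / 2 ^ (2 * Suc m) / fact (n + Suc m) /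
      fact (n + Suc m) / fact (2 * n + 1) * ((48 * of_nat n ^ 2 + 32 * of_nat n + 3) / 2 ^ 4 + (2 * of_nat n + 1) * of_nat (Suc m)))"
    unfolding VG_def V_def by (simp only: power_mult power2_eq_square) (simp add: mult_ac)
  show ?thesis
    unfolding e using b
    by (intro pmul_mult pmul_half_poch pint_mult pint_add pint_divide_fact pint_divide_2_power
      pint_power pint_half_poch pint_of_nat pint_1 pint_numeral)
qed

text \<open>Here (2m + 3)! may contain p, as for p = 5, but the square of
  \<open>half_poch (2 * Suc m)\<close> supplies p twice.\<close>

lemma pmul_VF:
  assumes j: "j < Suc m" and m: "m = p div 4"
  shows "VF (Suc m) j \<in> pmul p"
proof -
  have b: "p < 2 * (2 * Suc m)" "Suc m + j < p" "2 * Suc m + 1 < 2 * p"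
    using j div_4_bounds by (simp_all add: m)
  have "(16 :: rat) = 2 ^ 4" "(4 :: rat) = 2 ^ 2" by simp_all
  then have e: "VF (Suc m) j = half_poch (2 * Suc m) * half_poch (2 * Suc m) / fact (2 * Suc m + 1) *
     (half_poch (2 * j) / 2 ^ (4 * Suc m) / 2 ^ (2 * j) / fact (Suc m + j) / fact (Suc m + j) *
       (2 * of_nat (Suc m) * (2 * of_nat (Suc m) + 1)))"
    unfolding VF_def V_def by (simp only: power_mult power2_eq_square) (simp add: mult_ac)
  show ?thesis
    unfolding e using b
    by (intro pmul_mult pmul_square_divide_fact pmul_half_poch pint_mult pint_add pint_divide_fact pint_divide_2_power
      pint_power pint_half_poch pint_of_nat pint_1 pint_numeral)
qed

section \<open>The two quadratic sums\<close>

lemma sum_alternating: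
  "(\<Sum>n<p. (-1) ^ n * (40 * of_nat n ^ 2 + 24 * of_nat n + 3) * hyp n) \<in> pmul p"
proof (rule pmul_sum_hyp)
  \<comment> \<open>J = (p + 1)/2 is the least index with p dividing \<open>half_poch J\<close>, and
    it makes 1/2 - J = -p/2.\<close>
  obtain J where J: "2 * J = Suc p" using odd_p by (metis dvdE even_Suc)
  let ?M = "Suc (p div 4)"
  have "(\<Sum>n<?M. (-1) ^ n * (40 * of_nat n ^ 2 + 24 * of_nat n + 3) * hyp n) = (\<Sum>n<?M. 4 * UG n 0)"
  proof (rule sum.cong [OF refl])
    fix n
    show "(-1) ^ n * (40 * of_nat n ^ 2 + 24 * of_nat n + 3) * hyp n = 4 * UG n 0"
      using half_poch_pos [of n] by (simp add: UG_def U_def hyp_def)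
  qed
  also have "\<dots> = 4 * ((\<Sum>n<?M. UG n J) - (\<Sum>j<J. UF ?M j - UF 0 j))"
    by (simp only: sum_distrib_left [symmetric] sum_telescope_2 [of UF UG, OF U_WZ, of ?M J])
  also have "\<dots> \<in> pmul p"
  proof (intro pmul_mult' pmul_diff pmul_sum)
    fix n assume "n \<in> {..<?M}"
    then show "UG n J \<in> pmul p" using J by (intro pmul_UG) auto
  next
    fix j assume "j \<in> {..<J}"
    then have "2 * j < Suc p" using J by simp
    then show "UF ?M j \<in> pmul p" by (rule pmul_UF) (rule refl)
  qed (simp_all add: UF_def)
  finally show "(\<Sum>n<?M. (-1) ^ n * (40 * of_nat n ^ 2 + 24 * of_nat n + 3) * hyp n) \<in> pmul p" .
qed (intro pint_mult pint_add pint_power pint_uminus pint_of_nat pint_1 pint_numeral)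

lemma sum_quarter:
  "(\<Sum>n<p. (48 * of_nat n ^ 2 + 32 * of_nat n + 3) / 2 ^ (4 * n) * hyp n) \<in> pmul p"
proof (rule pmul_sum_hyp)
  let ?M = "Suc (p div 4)"
  have "(\<Sum>n<?M. (48 * of_nat n ^ 2 + 32 * of_nat n + 3) / 2 ^ (4 * n) * hyp n) = (\<Sum>n<?M. 16 * VG n 0)"
  proof (rule sum.cong [OF refl])
    fix n
    have "(2 :: rat) ^ (4 * n) = 16 ^ n" by (simp add: power_mult)
    then show "(48 * of_nat n ^ 2 + 32 * of_nat n + 3) / 2 ^ (4 * n) * hyp n = 16 * VG n 0"
      by (simp add: VG_def V_def hyp_def mult_ac)
  qed
  also have "\<dots> = 16 * ((\<Sum>n<?M. VG n ?M) - (\<Sum>j<?M. VF ?M j - VF 0 j))"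
    by (simp only: sum_distrib_left [symmetric] sum_telescope_2 [of VF VG, OF V_WZ, of ?M ?M])
  also have "\<dots> \<in> pmul p"
  proof (intro pmul_mult' pmul_diff pmul_sum)
    \<comment> \<open>The rectangle is a square of side \<open>?M\<close>, so both edges run over
      the same index set.\<close>
    fix n assume "n \<in> {..<?M}"
    then have "n < ?M" by simp
    then show "VG n ?M \<in> pmul p" "VF ?M n \<in> pmul p"
      using pmul_VG [OF _ refl] pmul_VF [OF _ refl] by blast+
  qed (simp_all add: VF_def)
  finally show "(\<Sum>n<?M. (48 * of_nat n ^ 2 + 32 * of_nat n + 3) / 2 ^ (4 * n) * hyp n) \<in> pmul p" .
qed (intro pint_mult pint_add pint_power pint_divide_2_power pint_of_nat pint_1 pint_numeral)

end

section \<open>Gosper telescoping for the cubic sums\<close>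

text \<open>The cubic summands differ from multiples of the quadratic ones by differences of
  \<^term>\<open>gosper\<close>, so the second and fourth congruences reduce to the first and third.\<close>

definition gosper :: "nat \<Rightarrow> rat" where
  "gosper n = of_nat n ^ 3 * (2 * of_nat n + 1) * hyp n"

text \<open>The prefactor of \<open>gosper (Suc n)\<close> is, up to 32, the denominator of the
  ratio in \<open>hyp_Suc\<close>, so only a polynomial multiple of \<open>hyp n\<close>
  remains.\<close>

lemma gosper_Suc: "gosper (Suc n) = hyp n * ((4 * of_nat n + 1) ^ 2 * (4 * of_nat n + 3) ^ 2) / 32"
proof -
  define s t :: rat where "s = of_nat n + 1" and "t = 2 * of_nat n + 3"
  have "s \<noteq> 0" "t \<noteq> 0" by (simp_all add: s_def t_def)
  moreover have "gosper (Suc n) = s ^ 3 * t * hyp (Suc n)"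
    by (simp add: gosper_def s_def t_def algebra_simps)
  ultimately show ?thesis
    unfolding hyp_Suc s_def [symmetric] t_def [symmetric] by simp
qed

text \<open>Without the common factor \<open>(-1) ^ n * hyp n\<close> both sides are quartic
  polynomials in n; the leading coefficients (160 = 16 * 10) fix -16, and the constant terms (3 =
  9/2 - 3/2) then fix -1/2.\<close>

lemma alternating_gosper:
  "(-1) ^ n * (80 * of_nat n ^ 3 + 96 * of_nat n ^ 2 + 30 * of_nat n + 3) * (2 * of_nat n + 1) * hyp n =
    - 16 * ((-1) ^ Suc n * gosper (Suc n) - (-1) ^ n * gosper n)
    - 1/2 * ((-1) ^ n * (40 * of_nat n ^ 2 + 24 * of_nat n + 3) * hyp n)"
proof -
  define s :: rat where "s = (-1) ^ n"
  show ?thesis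
    unfolding gosper_Suc unfolding gosper_def power_Suc s_def [symmetric] by (simp add: field_simps) algebra
qed

text \<open>The same comparison: the leading coefficients give -192 = 128 * (1/2 - 2), the constant
  terms 3 = 9/4 + 3/4.\<close>

lemma quarter_gosper:
  "(- 96 * of_nat n ^ 3 + 48 * of_nat n ^ 2 + 26 * of_nat n + 3) / 2 ^ (4 * n) * (2 * of_nat n + 1) * hyp n =
    128 * (gosper (Suc n) / 2 ^ (4 * Suc n) - gosper n / 2 ^ (4 * n))
    + 1/2 ^ 2 * ((48 * of_nat n ^ 2 + 32 * of_nat n + 3) / 2 ^ (4 * n) * hyp n)"
proof -
  define s :: rat where "s = 2 ^ (4 * n)"
  have 1: "(2 :: rat) ^ (4 * Suc n) = 16 * s" by (simp add: s_def power_add)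
  have "s \<noteq> 0" by (simp add: s_def)
  then show ?thesis
    unfolding gosper_Suc 1 unfolding gosper_def s_def [symmetric] by (simp add: field_simps) algebra
qed

context odd_prime
begin

text \<open>The cube in \<open>gosper\<close> contributes p, and \<open>hyp p\<close> is
  p-integral.\<close>

lemma pmul_gosper_p: "gosper p \<in> pmul p"
proof -
  have e: "gosper p = of_nat p * (of_nat p ^ 2 * (2 * of_nat p + 1) * hyp p)"
    by (simp add: gosper_def power2_eq_square power3_eq_cube)
  show ?thesis
    unfolding e by (intro pmul_prime pint_mult pint_add pint_power pint_hyp_p pint_of_nat pint_1 pint_numeral)
qed

lemma sum_alternating_cubic:
  "(\<Sum>n<p. (-1) ^ n * (80 * of_nat n ^ 3 + 96 * of_nat n ^ 2 + 30 * of_nat n + 3) * (2 * of_nat n + 1) * hyp n)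
     \<in> pmul p"
proof -
  \<comment> \<open>Only the upper end point of the telescoping survives, because
    \<open>gosper 0 = 0\<close>.\<close>
  have e: "(\<Sum>n<p. (-1) ^ n * (80 * of_nat n ^ 3 + 96 * of_nat n ^ 2 + 30 * of_nat n + 3) * (2 * of_nat n + 1) * hyp n)
    = - 16 * ((-1) ^ p * gosper p)
      - 1/2 * (\<Sum>n<p. (-1) ^ n * (40 * of_nat n ^ 2 + 24 * of_nat n + 3) * hyp n)"
    unfolding alternating_gosper sum_subtractf [of _ "\<lambda>n. 1/2 * _ n"] sum_distrib_left [symmetric]
      sum_lessThan_telescope [of "\<lambda>n. (-1) ^ n * gosper n"]
    by (simp add: gosper_def)
  show ?thesis
    unfolding e
    by (intro pmul_diff pmul_mult' pint_mult pint_uminus pint_power pint_half pmul_gosper_p sum_alternating pint_1 pint_numeral)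
qed

lemma sum_quarter_cubic:
  "(\<Sum>n<p. (- 96 * of_nat n ^ 3 + 48 * of_nat n ^ 2 + 26 * of_nat n + 3) / 2 ^ (4 * n) * (2 * of_nat n + 1) * hyp n)
     \<in> pmul p"
proof -
  have e: "(\<Sum>n<p. (- 96 * of_nat n ^ 3 + 48 * of_nat n ^ 2 + 26 * of_nat n + 3) / 2 ^ (4 * n) * (2 * of_nat n + 1) * hyp n)
    = 128 / 2 ^ (4 * p) * gosper p
      + 1/2 ^ 2 * (\<Sum>n<p. (48 * of_nat n ^ 2 + 32 * of_nat n + 3) / 2 ^ (4 * n) * hyp n)"
    unfolding quarter_gosper sum.distrib sum_distrib_left [symmetric]
      sum_lessThan_telescope [of "\<lambda>n. gosper n / 2 ^ (4 * n)"]
    by (simp add: gosper_def)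
  show ?thesis
    unfolding e
    by (intro pmul_add pmul_mult' pint_divide_2_power pmul_gosper_p sum_quarter pint_1 pint_numeral)
qed

end

theorem theorem8:
  fixes p :: nat
  assumes "prime p" and "p > 2"
  shows "rat_cong p 1
           (\<Sum>n=0..p-1. (-1) ^ n * (40 * of_nat n ^ 2 + 24 * of_nat n + 3)
              / (2 ^ (8 * n) * (2 * of_nat n + 1))
              * of_nat ((4 * n) choose (2 * n)) ^ 2 * of_nat ((2 * n) choose n)) 0
       \<and> rat_cong p 1
           (\<Sum>n=0..p-1. (-1) ^ n * (80 * of_nat n ^ 3 + 96 * of_nat n ^ 2 + 30 * of_nat n + 3)
              / 2 ^ (8 * n)
              * of_nat ((4 * n) choose (2 * n)) ^ 2 * of_nat ((2 * n) choose n)) 0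
       \<and> rat_cong p 1
           (\<Sum>n=0..p-1. (48 * of_nat n ^ 2 + 32 * of_nat n + 3)
              / (2 ^ (12 * n) * (2 * of_nat n + 1))
              * of_nat ((4 * n) choose (2 * n)) ^ 2 * of_nat ((2 * n) choose n)) 0
       \<and> rat_cong p 1
           (\<Sum>n=0..p-1. (- 96 * of_nat n ^ 3 + 48 * of_nat n ^ 2 + 26 * of_nat n + 3)
              / 2 ^ (12 * n)
              * of_nat ((4 * n) choose (2 * n)) ^ 2 * of_nat ((2 * n) choose n)) 0"
proof -
  interpret odd_prime p using assms by unfold_locales
  have set: "{0..p - 1} = {..<p}" using assms by auto
  have binom: "a / b * of_nat ((4 * n) choose (2 * n)) ^ 2 * of_nat ((2 * n) choose n) =
      a / b * (2 ^ (8 * n) * (2 * of_nat n + 1) * hyp n)" for a b :: rat and n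
    unfolding mult.assoc binomials_eq_hyp [unfolded mult.assoc] ..
  have 12: "(2 :: rat) ^ (12 * n) = 2 ^ (8 * n) * 2 ^ (4 * n)" for n
    by (simp flip: power_add)
  \<comment> \<open>One shape of denominator for each of the four sums, in their order.\<close>
  have cancel: "a / (b * c) * (b * c * h) = a * h" "a / b * (b * c * h) = a * c * h"
     "a / (b * d * c) * (b * c * h) = a / d * h" "a / (b * d) * (b * c * h) = a / d * c * h"
     if "b \<noteq> 0" "c \<noteq> 0" for a b c d h :: rat
    using that by simp_all
  show ?thesis
    unfolding set binom 12
    by (intro conjI rat_cong_0_if_pmul assms)
      (simp_all only: cancel linear_of_nat_neq_0 power_not_zero [OF zero_neq_numeral [symmetric]] not_False_eq_True
         sum_alternating sum_alternating_cubic sum_quarter sum_quarter_cubic)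
qed

end
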